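(* Let $(p^{n+\frac12},E^{n+\frac12},H^{n+1})_{n=0}^{N-1}$ be a solution of the LF$_4$ time semidiscretization of the three-field Maxwell system (the bootstrap step for $n=0$ and the general step for $n=1,\dots,N-1$, both written out in the context) started from the initial data $(p_0,E_0,H_0)$. Then, for any fixed time step $\Delta t>0$ sufficiently small, the discrete energy is conserved: $$\mathcal E^N:=\|p^{N-\frac12}\|^2_{\varepsilon^{-1}}+\|E^{N-\frac12}\|^2_{\varepsilon}+\|H^N\|^2_{\mu}=\|p_0\|^2_{\varepsilon^{-1}}+\|E_0\|^2_{\varepsilon}+\|H_0\|^2_{\mu}=:\mathcal E^0 .$$
   Context: **Setting.** $\Omega\subset\mathbb R^d$, $d\in\{2,3\}$, is a domain with Lipschitz boundary and unit outward normal $\mathbf n$; $T>0$; $\varepsilon,\mu>0$ are constants. (For $d=2$ the usual two-dimensional counterparts of the operators and spaces are used.) $\langle\cdot,\cdot\rangle$ is the $L^2(\Omega)$ inner product, $\langle u,v\rangle_\alpha:=\langle\alpha u,v\rangle$ and $\|u\|_\alpha^2:=\langle u,u\rangle_\alpha$ for $\alpha\in\{\varepsilon^{-1},\varepsilon,\mu\}$. The spaces $\mathring H^1_{\varepsilon^{-1}}(\Omega)$, $\mathring H_\varepsilon(\mathrm{curl};\Omega)$, $\mathring H_\mu(\mathrm{div};\Omega)$ are $H^1(\Omega)$, $H(\mathrm{curl};\Omega)$, $H(\mathrm{div};\Omega)$ with the indicated $L^2$ weights and with homogeneous boundary conditions $p=0$, $E\times \mathbf n=0$, $H\cdot \mathbf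 n=0$ on $\partial\Omega$ respectively. The continuous system is $\partial_t p+\nabla\cdot\varepsilon E=0$, $\nabla p+\varepsilon\partial_tE-\nabla\times H=0$, $\mu\partial_tH+\nabla\times E=0$ in $\Omega\times(0,T]$, with these boundary conditions and initial data $p_0,E_0,H_0$ satisfying $\nabla\cdot(\varepsilon E_0)=p_0$, $\nabla\cdot(\mu H_0)=0$. **Time grid.** $t^n=n\Delta t$, $t^{n+\frac12}=(n+\frac12)\Delta t$, $n=0,\dots,N$, $N\Delta t\approx T$ (e.g. $N=\lfloor T/\Delta t\rfloor$). **LF$_4$ scheme.** The unknowns are $p^{n+\frac12}\in\mathring H^1_{\varepsilon^{-1}}(\Omega)$, $E^{n+\frac12}\in\mathring H_\varepsilon(\mathrm{curl};\Omega)$, $H^{n+1}\in\mathring H_\mu(\mathrm{div};\Omega)$. Write $\bar p=\frac12(p^{n+\frac12}+p^{n-\frac12})$, $\bar E=\frac12(E^{n+\frac12}+E^{n-\frac12})$, $\bar H=\frac12(H^{n+1}+H^n)$. For $n=1,\dots,N-1$ and all $\tilde p\in\mathring H^1_{\varepsilon^{-1}}(\Omega)$, $\tilde E\in\mathring H_\varepsilon(\mathrm{curl};\Omega)$, $\tilde H\in\mathring H_\mu(\mathrm{div};\Omega)$: $$\Big\langle\tfrac{p^{n+\frac12}-p^{n-\frac12}}{\Delta t},\tilde p\Big\rangle-\langle\varepsilon\bar E,\nabla\tilde p\rangle+\tfrac{\Delta t^2}{12}\langle\varepsilon\nabla\nabla\cdot\bar E,\nabla\tilde p\rangle=0,$$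 $$\langle\nabla\bar p,\tilde E\rangle-\tfrac{\Delta t^2}{12}\langle\nabla\bar p,\nabla\nabla\cdot\tilde E\rangle+\Big\langle\varepsilon\tfrac{E^{n+\frac12}-E^{n-\frac12}}{\Delta t},\tilde E\Big\rangle-\langle\bar H,\nabla\times\tilde E\rangle-\tfrac{\Delta t^2}{12}\langle\mu^{-1}\varepsilon^{-1}\nabla\times\nabla\times\bar H,\nabla\times\tilde E\rangle=0,$$ $$\Big\langle\mu\tfrac{H^{n+1}-H^n}{\Delta t},\tilde H\Big\rangle+\langle\nabla\times\bar E,\tilde H\rangle+\tfrac{\Delta t^2}{12}\langle\varepsilon^{-1}\mu^{-1}\nabla\times\bar E,\nabla\times\nabla\times\tilde H\rangle=0.$$ Bootstrap step ($n=0$), with $\hat p=\frac12(p^{\frac12}+p_0)$, $\hat E=\frac12(E^{\frac12}+E_0)$, $\hat H=\frac12(H^1+H_0)$: $$\Big\langle\tfrac{p^{\frac12}-p_0}{\Delta t/2},\tilde p\Big\rangle-\tfrac12\langle\varepsilon\hat E,\nabla\tilde p\rangle+\tfrac18\tfrac{\Delta t^2}{12}\langle\varepsilon\nabla\nabla\cdot\hat E,\nabla\tilde p\rangle=0,$$ $$\tfrac12\langle\nabla\hat p,\tilde E\rangle-\tfrac18\tfrac{\Delta t^2}{12}\langle\nabla\hat p,\nabla\nabla\cdot\tilde E\rangle+\Big\langle\varepsilon\tfrac{E^{\frac12}-E_0}{\Delta t/2},\tilde E\Big\rangle-\langle\hat H,\nabla\times\tilde E\rangle-\tfrac14\tfrac{\Delta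 t^2}{12}\langle\mu^{-1}\varepsilon^{-1}\nabla\times\nabla\times\hat H,\nabla\times\tilde E\rangle=0,$$ $$\Big\langle\mu\tfrac{H^1-H_0}{\Delta t},\tilde H\Big\rangle+\tfrac12\langle\nabla\times\hat E,\tilde H\rangle+\tfrac18\tfrac{\Delta t^2}{12}\langle\varepsilon^{-1}\mu^{-1}\nabla\times\hat E,\nabla\times\nabla\times\tilde H\rangle=0.$$ Standing convention: the data, the solutions and the test functions are regular enough in space that every term written is defined (in particular the scheme's iterates are themselves admissible test functions). *)

theory Defs
  imports "HOL-Analysis.Analysis"
begin

section \<open>Domains\<close>

text \<open>Near each boundary point the set is, in suitable orthonormal coordinates, the part of space
  strictly above the graph of a Lipschitz function; \<open>e\<close> is the vertical direction and
  \<open>y - (e \<bullet> y) *\<^sub>R e\<close> is the horizontal part of \<open>y\<close>.\<close>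

definition lipschitz_boundary :: "'a::euclidean_space set \<Rightarrow> bool" where
  "lipschitz_boundary \<Omega> \<longleftrightarrow>
    (\<forall>x\<in>frontier \<Omega>. \<exists>r>0. \<exists>e. \<exists>L. \<exists>\<gamma> :: 'a \<Rightarrow> real. norm e = 1 \<and> L-lipschitz_on {z. e \<bullet> z = 0} \<gamma> \<and>
      \<Omega> \<inter> ball x r = {y \<in> ball x r. \<gamma> (y - (e \<bullet> y) *\<^sub>R e) < e \<bullet> y})"

definition lipschitz_domain :: "'a::euclidean_space set \<Rightarrow> bool" where
  "lipschitz_domain \<Omega> \<longleftrightarrow> open \<Omega> \<and> connected \<Omega> \<and> \<Omega> \<noteq> {} \<and> lipschitz_boundary \<Omega>"


section \<open>Square integrable fields\<close>

text \<open>Fields are functions on the whole space of which only the values on \<open>\<Omega>\<close>, up to null sets,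
  matter. Scalar fields are the case \<open>'b = real\<close>, where \<open>\<bullet>\<close> is multiplication.\<close>

definition L2 :: "'a::euclidean_space set \<Rightarrow> ('a \<Rightarrow> 'b::euclidean_space) set" where
  "L2 \<Omega> = {u. u \<in> borel_measurable (lebesgue_on \<Omega>) \<and>
               integrable (lebesgue_on \<Omega>) (\<lambda>x. (norm (u x))\<^sup>2)}"

definition l2_inner ::
  "('a::euclidean_space \<Rightarrow> 'b::euclidean_space) \<Rightarrow> ('a \<Rightarrow> 'b) \<Rightarrow> 'a set \<Rightarrow> real"
  ("\<langle>_,/ _\<rangle>\<^bsub>_\<^esub>") where
  "\<langle>u, v\<rangle>\<^bsub>\<Omega>\<^esub> = (LINT x|lebesgue_on \<Omega>. u x \<bullet> v x)"

definition l2_inner_weighted ::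
  "('a::euclidean_space \<Rightarrow> 'b::euclidean_space) \<Rightarrow> ('a \<Rightarrow> 'b) \<Rightarrow> 'a set \<Rightarrow> real \<Rightarrow> real"
  ("\<langle>_,/ _\<rangle>\<^bsub>_,_\<^esub>") where
  "\<langle>u, v\<rangle>\<^bsub>\<Omega>,\<alpha>\<^esub> = \<langle>\<lambda>x. \<alpha> *\<^sub>R u x, v\<rangle>\<^bsub>\<Omega>\<^esub>"


section \<open>Test functions\<close>

primrec Ck :: "nat \<Rightarrow> ('a::euclidean_space \<Rightarrow> 'b::euclidean_space) \<Rightarrow> bool" where
  "Ck 0 f \<longleftrightarrow> continuous_on UNIV f"
| "Ck (Suc k) f \<longleftrightarrow> f differentiable_on UNIV \<and>
     (\<forall>b\<in>Basis. Ck k (\<lambda>x. frechet_derivative f (at x) b))"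

definition test_functions :: "'a::euclidean_space set \<Rightarrow> ('a \<Rightarrow> 'b::euclidean_space) set" where
  "test_functions \<Omega> = {\<phi>. (\<forall>k. Ck k \<phi>) \<and>
     compact (closure {x. \<phi> x \<noteq> 0}) \<and> closure {x. \<phi> x \<noteq> 0} \<subseteq> \<Omega>}"


section \<open>First order differential operators and their Sobolev spaces\<close>

text \<open>Gradient, divergence and the curls are the operators
  \<open>u \<mapsto> (\<Sum>b\<in>Basis. \<sigma> b (\<partial>\<^sub>b u))\<close> for bilinear \<open>\<sigma>\<close>; formally they arise by putting \<open>\<nabla>\<close> in the first
  argument of \<open>\<sigma>\<close>:

  \<^item> gradient: \<open>\<sigma> \<xi> s = s *\<^sub>R \<xi>\<close>;
  \<^item> divergence: \<open>\<sigma> \<xi> v = \<xi> \<bullet> v\<close>;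
  \<^item> curl in three dimensions: \<open>\<sigma> \<xi> v = cross3 \<xi> v\<close>;
  \<^item> scalar curl of a planar vector field, \<open>\<partial>\<^sub>1 v\<^sub>2 - \<partial>\<^sub>2 v\<^sub>1\<close>: \<open>\<sigma> = rot2\<close> below;
  \<^item> vector curl of a planar scalar field, \<open>(\<partial>\<^sub>2 s, - \<partial>\<^sub>1 s)\<close>: \<open>\<sigma> = vrot2\<close> below.\<close>

type_synonym ('a, 'b, 'c) symb = "'a \<Rightarrow> 'b \<Rightarrow> 'c"

definition grad_symb :: "('a::euclidean_space, real, 'a) symb" where
  "grad_symb \<xi> s = s *\<^sub>R \<xi>"

definition div_symb :: "('a::euclidean_space, 'a, real) symb" where
  "div_symb \<xi> v = \<xi> \<bullet> v"

definition rot2 :: "(real^2, real^2, real) symb" where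
  "rot2 \<xi> v = \<xi>$1 * v$2 - \<xi>$2 * v$1"

definition vrot2 :: "(real^2, real, real^2) symb" where
  "vrot2 \<xi> s = vector [\<xi>$2 * s, - (\<xi>$1 * s)]"

definition classical_op ::
  "('a, 'b, 'c) symb \<Rightarrow> ('a::euclidean_space \<Rightarrow> 'b::euclidean_space) \<Rightarrow> 'a \<Rightarrow> 'c::euclidean_space" where
  "classical_op \<sigma> u x = (\<Sum>b\<in>Basis. \<sigma> b (frechet_derivative u (at x) b))"

text \<open>\<open>has_weak_op \<Omega> \<sigma> u v\<close>: both fields are in \<open>L2\<close> and \<open>v\<close> is the distributional image of \<open>u\<close>, by
  integration by parts against scalar \<open>\<phi>\<close>. For the curl, say, the identity reads
  \<open>\<integral> \<phi> v = - \<integral> \<nabla>\<phi> \<times> u\<close>.\<close>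

definition has_weak_op ::
  "'a set \<Rightarrow> ('a, 'b, 'c) symb \<Rightarrow> ('a::euclidean_space \<Rightarrow> 'b::euclidean_space) \<Rightarrow>
   ('a \<Rightarrow> 'c::euclidean_space) \<Rightarrow> bool" where
  "has_weak_op \<Omega> \<sigma> u v \<longleftrightarrow> u \<in> L2 \<Omega> \<and> v \<in> L2 \<Omega> \<and>
    (\<forall>\<phi> \<in> test_functions \<Omega>.
      (LINT x|lebesgue_on \<Omega>. \<phi> x *\<^sub>R v x) =
      - (LINT x|lebesgue_on \<Omega>. \<sigma> (classical_op grad_symb \<phi> x) (u x)))"

text \<open>A representative of the (almost everywhere unique) weak image; unspecified if there is none.\<close>

definition weak_op ::
  "'a set \<Rightarrow> ('a, 'b, 'c) symb \<Rightarrow> ('a::euclidean_space \<Rightarrow> 'b::euclidean_space) \<Rightarrow>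
   ('a \<Rightarrow> 'c::euclidean_space)" where
  "weak_op \<Omega> \<sigma> u = (SOME v. has_weak_op \<Omega> \<sigma> u v)"

abbreviation "grad \<Omega> \<equiv> weak_op \<Omega> grad_symb"
abbreviation "diverg \<Omega> \<equiv> weak_op \<Omega> div_symb"

definition sobolev ::
  "'a set \<Rightarrow> ('a, 'b, 'c::euclidean_space) symb \<Rightarrow> ('a::euclidean_space \<Rightarrow> 'b::euclidean_space) set" where
  "sobolev \<Omega> \<sigma> = {u. \<exists>v. has_weak_op \<Omega> \<sigma> u v}"

text \<open>The subspace with homogeneous boundary condition (\<open>u = 0\<close>, \<open>u \<times> n = 0\<close>, \<open>u \<bullet> n = 0\<close> for
  gradient, curl and divergence): the closure of the test functions in the graph norm.
  A constant positive weight in the norm does not change the space.\<close>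

definition sobolev0 ::
  "'a set \<Rightarrow> ('a, 'b, 'c::euclidean_space) symb \<Rightarrow> ('a::euclidean_space \<Rightarrow> 'b::euclidean_space) set" where
  "sobolev0 \<Omega> \<sigma> = {u. \<exists>v. has_weak_op \<Omega> \<sigma> u v \<and>
     (\<exists>\<phi>. (\<forall>k::nat. \<phi> k \<in> test_functions \<Omega>) \<and>
       (\<lambda>k. LINT x|lebesgue_on \<Omega>. (norm (\<phi> k x - u x))\<^sup>2) \<longlonglongrightarrow> 0 \<and>
       (\<lambda>k. LINT x|lebesgue_on \<Omega>. (norm (classical_op \<sigma> (\<phi> k) x - v x))\<^sup>2) \<longlonglongrightarrow> 0)}"


section \<open>Function spaces of the scheme\<close>

text \<open>In the following \<open>\<kappa>\<close> is the symbol of the curl acting on \<open>E\<close> and \<open>\<kappa>'\<close> that of the curl acting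
  on \<open>H\<close>. The extra regularity in \<open>E_space\<close> and \<open>H_space\<close> is what is needed for \<open>\<nabla>\<nabla>\<bullet>E\<close> and
  \<open>\<nabla>\<times>\<nabla>\<times>H\<close> to exist in \<open>L2\<close>.\<close>

definition p_space :: "'a::euclidean_space set \<Rightarrow> ('a \<Rightarrow> real) set" where
  "p_space \<Omega> = sobolev0 \<Omega> grad_symb"

definition E_space ::
  "'a set \<Rightarrow> ('a, 'a, 'h::euclidean_space) symb \<Rightarrow> ('a::euclidean_space \<Rightarrow> 'a) set" where
  "E_space \<Omega> \<kappa> = {E \<in> sobolev0 \<Omega> \<kappa>. \<exists>q \<in> sobolev \<Omega> grad_symb. has_weak_op \<Omega> div_symb E q}"

definition H_space ::
  "'a set \<Rightarrow> ('a, 'a, 'h) symb \<Rightarrow> ('a, 'h, 'a) symb \<Rightarrow> ('a \<Rightarrow> 'h) set \<Rightarrow>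
   ('a::euclidean_space \<Rightarrow> 'h::euclidean_space) set" where
  "H_space \<Omega> \<kappa> \<kappa>' V = {H \<in> V. \<exists>C \<in> sobolev \<Omega> \<kappa>. has_weak_op \<Omega> \<kappa>' H C}"

abbreviation E_space3 :: "(real^3) set \<Rightarrow> (real^3 \<Rightarrow> real^3) set" where
  "E_space3 \<Omega> \<equiv> E_space \<Omega> cross3"

abbreviation H_space3 :: "(real^3) set \<Rightarrow> (real^3 \<Rightarrow> real^3) set" where
  "H_space3 \<Omega> \<equiv> H_space \<Omega> cross3 cross3 (sobolev0 \<Omega> div_symb)"

text \<open>In the plane \<open>H\<close> stands for the field \<open>(0, 0, H)\<close>: it is divergence free and orthogonal to the
  normal, so that \<open>L2\<close> takes the role of the space \<open>H(div)\<close> with zero normal component.\<close>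

abbreviation E_space2 :: "(real^2) set \<Rightarrow> (real^2 \<Rightarrow> real^2) set" where
  "E_space2 \<Omega> \<equiv> E_space \<Omega> rot2"

abbreviation H_space2 :: "(real^2) set \<Rightarrow> (real^2 \<Rightarrow> real) set" where
  "H_space2 \<Omega> \<equiv> H_space \<Omega> rot2 vrot2 (L2 \<Omega>)"


section \<open>The scheme\<close>

definition avg :: "('a \<Rightarrow> 'b::real_vector) \<Rightarrow> ('a \<Rightarrow> 'b) \<Rightarrow> 'a \<Rightarrow> 'b" where
  "avg u v = (\<lambda>x. (1/2) *\<^sub>R (u x + v x))"

definition diff_quot :: "real \<Rightarrow> ('a \<Rightarrow> 'b::real_vector) \<Rightarrow> ('a \<Rightarrow> 'b) \<Rightarrow> 'a \<Rightarrow> 'b" where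
  "diff_quot \<tau> u v = (\<lambda>x. (1/\<tau>) *\<^sub>R (u x - v x))"

text \<open>One step of length \<open>\<tau>\<close> from \<open>(p, E, H)\<close> to \<open>(p', E', H')\<close>; \<open>HV\<close> is the space of \<open>H\<close>.\<close>

definition lf4_step ::
  "'a set \<Rightarrow> ('a, 'a, 'h) symb \<Rightarrow> ('a, 'h, 'a) symb \<Rightarrow> ('a \<Rightarrow> 'h) set \<Rightarrow> real \<Rightarrow> real \<Rightarrow> real \<Rightarrow>
   ('a \<Rightarrow> real) \<Rightarrow> ('a \<Rightarrow> 'a) \<Rightarrow> ('a \<Rightarrow> 'h) \<Rightarrow>
   ('a \<Rightarrow> real) \<Rightarrow> ('a::euclidean_space \<Rightarrow> 'a) \<Rightarrow> ('a \<Rightarrow> 'h::euclidean_space) \<Rightarrow> bool" where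
  "lf4_step \<Omega> \<kappa> \<kappa>' HV \<epsilon> \<mu> \<tau> p E H p' E' H' \<longleftrightarrow>
    (let pb = avg p' p; Eb = avg E' E; Hb = avg H' H; curlE = weak_op \<Omega> \<kappa>; curlH = weak_op \<Omega> \<kappa>' in
     (\<forall>q \<in> p_space \<Omega>.
        \<langle>diff_quot \<tau> p' p, q\<rangle>\<^bsub>\<Omega>\<^esub>
        - \<langle>Eb, grad \<Omega> q\<rangle>\<^bsub>\<Omega>,\<epsilon>\<^esub>
        + \<tau>\<^sup>2 / 12 * \<langle>grad \<Omega> (diverg \<Omega> Eb), grad \<Omega> q\<rangle>\<^bsub>\<Omega>,\<epsilon>\<^esub> = 0) \<and>
     (\<forall>F \<in> E_space \<Omega> \<kappa>.
        \<langle>grad \<Omega> pb, F\<rangle>\<^bsub>\<Omega>\<^esub>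
        - \<tau>\<^sup>2 / 12 * \<langle>grad \<Omega> pb, grad \<Omega> (diverg \<Omega> F)\<rangle>\<^bsub>\<Omega>\<^esub>
        + \<langle>diff_quot \<tau> E' E, F\<rangle>\<^bsub>\<Omega>,\<epsilon>\<^esub>
        - \<langle>Hb, curlE F\<rangle>\<^bsub>\<Omega>\<^esub>
        - \<tau>\<^sup>2 / 12 * \<langle>curlE (curlH Hb), curlE F\<rangle>\<^bsub>\<Omega>,1/(\<mu>*\<epsilon>)\<^esub> = 0) \<and>
     (\<forall>G \<in> HV.
        \<langle>diff_quot \<tau> H' H, G\<rangle>\<^bsub>\<Omega>,\<mu>\<^esub>
        + \<langle>curlE Eb, G\<rangle>\<^bsub>\<Omega>\<^esub>
        + \<tau>\<^sup>2 / 12 * \<langle>curlE Eb, curlE (curlH G)\<rangle>\<^bsub>\<Omega>,1/(\<epsilon>*\<mu>)\<^esub> = 0))"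

text \<open>The first step: \<open>p\<close> and \<open>E\<close> advance by \<open>\<tau>/2\<close>, \<open>H\<close> by \<open>\<tau>\<close>.\<close>

definition lf4_bootstrap ::
  "'a set \<Rightarrow> ('a, 'a, 'h) symb \<Rightarrow> ('a, 'h, 'a) symb \<Rightarrow> ('a \<Rightarrow> 'h) set \<Rightarrow> real \<Rightarrow> real \<Rightarrow> real \<Rightarrow>
   ('a \<Rightarrow> real) \<Rightarrow> ('a \<Rightarrow> 'a) \<Rightarrow> ('a \<Rightarrow> 'h) \<Rightarrow>
   ('a \<Rightarrow> real) \<Rightarrow> ('a::euclidean_space \<Rightarrow> 'a) \<Rightarrow> ('a \<Rightarrow> 'h::euclidean_space) \<Rightarrow> bool" where
  "lf4_bootstrap \<Omega> \<kappa> \<kappa>' HV \<epsilon> \<mu> \<tau> p E H p' E' H' \<longleftrightarrow>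
    (let pb = avg p' p; Eb = avg E' E; Hb = avg H' H; curlE = weak_op \<Omega> \<kappa>; curlH = weak_op \<Omega> \<kappa>' in
     (\<forall>q \<in> p_space \<Omega>.
        \<langle>diff_quot (\<tau>/2) p' p, q\<rangle>\<^bsub>\<Omega>\<^esub>
        - 1/2 * \<langle>Eb, grad \<Omega> q\<rangle>\<^bsub>\<Omega>,\<epsilon>\<^esub>
        + 1/8 * (\<tau>\<^sup>2 / 12) * \<langle>grad \<Omega> (diverg \<Omega> Eb), grad \<Omega> q\<rangle>\<^bsub>\<Omega>,\<epsilon>\<^esub> = 0) \<and>
     (\<forall>F \<in> E_space \<Omega> \<kappa>.
        1/2 * \<langle>grad \<Omega> pb, F\<rangle>\<^bsub>\<Omega>\<^esub>
        - 1/8 * (\<tau>\<^sup>2 / 12) * \<langle>grad \<Omega> pb, grad \<Omega> (diverg \<Omega> F)\<rangle>\<^bsub>\<Omega>\<^esub>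
        + \<langle>diff_quot (\<tau>/2) E' E, F\<rangle>\<^bsub>\<Omega>,\<epsilon>\<^esub>
        - \<langle>Hb, curlE F\<rangle>\<^bsub>\<Omega>\<^esub>
        - 1/4 * (\<tau>\<^sup>2 / 12) * \<langle>curlE (curlH Hb), curlE F\<rangle>\<^bsub>\<Omega>,1/(\<mu>*\<epsilon>)\<^esub> = 0) \<and>
     (\<forall>G \<in> HV.
        \<langle>diff_quot \<tau> H' H, G\<rangle>\<^bsub>\<Omega>,\<mu>\<^esub>
        + 1/2 * \<langle>curlE Eb, G\<rangle>\<^bsub>\<Omega>\<^esub>
        + 1/8 * (\<tau>\<^sup>2 / 12) * \<langle>curlE Eb, curlE (curlH G)\<rangle>\<^bsub>\<Omega>,1/(\<epsilon>*\<mu>)\<^esub> = 0))"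

text \<open>Staggered indexing: \<open>p n\<close> and \<open>E n\<close> are the values at time \<open>(n + 1/2) * \<tau>\<close>, \<open>H n\<close> is the value
  at time \<open>n * \<tau>\<close> for \<open>n \<ge> 1\<close> (\<open>H 0\<close> is not used). Only \<open>p n\<close>, \<open>E n\<close>, \<open>H (Suc n)\<close> with \<open>n < N\<close> are
  constrained.\<close>

definition lf4_solution ::
  "'a set \<Rightarrow> ('a, 'a, 'h) symb \<Rightarrow> ('a, 'h, 'a) symb \<Rightarrow> ('a \<Rightarrow> 'h) set \<Rightarrow> real \<Rightarrow> real \<Rightarrow> real \<Rightarrow> nat \<Rightarrow>
   ('a \<Rightarrow> real) \<Rightarrow> ('a \<Rightarrow> 'a) \<Rightarrow> ('a \<Rightarrow> 'h) \<Rightarrow>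
   (nat \<Rightarrow> 'a \<Rightarrow> real) \<Rightarrow> (nat \<Rightarrow> 'a::euclidean_space \<Rightarrow> 'a) \<Rightarrow> (nat \<Rightarrow> 'a \<Rightarrow> 'h::euclidean_space) \<Rightarrow> bool"
  where
  "lf4_solution \<Omega> \<kappa> \<kappa>' HV \<epsilon> \<mu> \<tau> N p0 E0 H0 p E H \<longleftrightarrow>
    (\<forall>n<N. p n \<in> p_space \<Omega> \<and> E n \<in> E_space \<Omega> \<kappa> \<and> H (Suc n) \<in> HV) \<and>
    lf4_bootstrap \<Omega> \<kappa> \<kappa>' HV \<epsilon> \<mu> \<tau> p0 E0 H0 (p 0) (E 0) (H 1) \<and>
    (\<forall>n\<in>{1..<N}. lf4_step \<Omega> \<kappa> \<kappa>' HV \<epsilon> \<mu> \<tau> (p (n - 1)) (E (n - 1)) (H n) (p n) (E n) (H (Suc n)))"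

abbreviation "lf4_solution3 \<Omega> \<equiv> lf4_solution \<Omega> cross3 cross3 (H_space3 \<Omega>)"
abbreviation "lf4_solution2 \<Omega> \<equiv> lf4_solution \<Omega> rot2 vrot2 (H_space2 \<Omega>)"

definition energy ::
  "'a set \<Rightarrow> real \<Rightarrow> real \<Rightarrow> ('a \<Rightarrow> real) \<Rightarrow> ('a::euclidean_space \<Rightarrow> 'a) \<Rightarrow>
   ('a \<Rightarrow> 'h::euclidean_space) \<Rightarrow> real" where
  "energy \<Omega> \<epsilon> \<mu> p E H = \<langle>p, p\<rangle>\<^bsub>\<Omega>,1/\<epsilon>\<^esub> + \<langle>E, E\<rangle>\<^bsub>\<Omega>,\<epsilon>\<^esub> + \<langle>H, H\<rangle>\<^bsub>\<Omega>,\<mu>\<^esub>"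

end

theory Submission
  imports Defs
begin

text \<open>Test the three equations with the averages of the old and new \<open>p\<close>, \<open>E\<close> and \<open>H\<close>, and divide the
  first one by \<open>\<epsilon>\<close>. All coupling terms cancel by symmetry of the inner product, and the difference quotients turn into
  differences of squared norms, since \<open>(u - v) \<bullet> (u + v) = u \<bullet> u - v \<bullet> v\<close>. Hence every step conserves
  the energy, whatever its length; a time step below \<open>T\<close> only excludes \<open>N = 0\<close>. What needs care is
  that the averages are admissible: the spaces of the scheme are closed under linear combinations.
  The same weak images then occur in all three equations, so that their uniqueness is not needed.\<close>

section \<open>Square integrable fields\<close>

lemma L2_measurable: "u \<in> L2 \<Omega> \<Longrightarrow> u \<in> borel_measurable (lebesgue_on \<Omega>)"
  by (simp add: L2_def)

lemma L2_integrable: "u \<in> L2 \<Omega> \<Longrightarrow> integrable (lebesgue_on \<Omega>) (\<lambda>x. (norm (u x))\<^sup>2)"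
  by (simp add: L2_def)

text \<open>The triangle inequality combined with
  \<open>(s + t)\<^sup>2 \<le> 2 * s\<^sup>2 + 2 * t\<^sup>2\<close>. It serves as the dominating
  function in \<open>L2_lincomb\<close> and as the upper bound in
  \<open>L2_convergent_lincomb\<close>.\<close>

lemma norm_lincomb_sq_le:
  fixes x y :: "'b::real_normed_vector"
  shows "(norm (a *\<^sub>R x + b *\<^sub>R y))\<^sup>2 \<le> 2 * a\<^sup>2 * (norm x)\<^sup>2 + 2 * b\<^sup>2 * (norm y)\<^sup>2"
proof -
  have "(norm (a *\<^sub>R x + b *\<^sub>R y))\<^sup>2 \<le> (\<bar>a\<bar> * norm x + \<bar>b\<bar> * norm y)\<^sup>2"
    using norm_triangle_ineq[of "a *\<^sub>R x" "b *\<^sub>R y"] by (intro power_mono) simp_all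
  also have "\<dots> \<le> 2 * (\<bar>a\<bar> * norm x)\<^sup>2 + 2 * (\<bar>b\<bar> * norm y)\<^sup>2"
    using sum_squares_bound[of "\<bar>a\<bar> * norm x" "\<bar>b\<bar> * norm y"] by (simp add: power2_sum)
  finally show ?thesis
    by (simp add: power_mult_distrib)
qed

lemma L2_lincomb:
  assumes "u \<in> L2 \<Omega>" "v \<in> L2 \<Omega>"
  shows "(\<lambda>x. a *\<^sub>R u x + b *\<^sub>R v x) \<in> L2 \<Omega>"
proof -
  note [measurable] = assms[THEN L2_measurable]
  have "integrable (lebesgue_on \<Omega>) (\<lambda>x. 2 * a\<^sup>2 * (norm (u x))\<^sup>2 + 2 * b\<^sup>2 * (norm (v x))\<^sup>2)"
    using assms[THEN L2_integrable] by simp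
  then have "integrable (lebesgue_on \<Omega>) (\<lambda>x. (norm (a *\<^sub>R u x + b *\<^sub>R v x))\<^sup>2)"
    by (rule Bochner_Integration.integrable_bound)
      (auto intro: order_trans[OF norm_lincomb_sq_le])
  then show ?thesis
    by (simp add: L2_def)
qed

lemma L2_diff: "u \<in> L2 \<Omega> \<Longrightarrow> v \<in> L2 \<Omega> \<Longrightarrow> (\<lambda>x. u x - v x) \<in> L2 \<Omega>"
  using L2_lincomb[of u \<Omega> v 1 "-1"] by simp

lemma L2_sum:
  "(\<And>i. i \<in> I \<Longrightarrow> f i \<in> L2 \<Omega>) \<Longrightarrow> (\<lambda>x. \<Sum>i\<in>I. f i x) \<in> L2 \<Omega>"
\<comment> \<open>A sum over an infinite index set is 0 by convention, so that case gives the zero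
  field, like the empty sum.\<close>
proof (induction I rule: infinite_finite_induct)
  case (insert i I)
  then show ?case
    using L2_lincomb[of "f i" \<Omega> "\<lambda>x. \<Sum>i\<in>I. f i x" 1 1] by simp
qed (simp_all add: L2_def)

lemma L2_bounded_linear:
  assumes "bounded_linear h" "u \<in> L2 \<Omega>"
  shows "(\<lambda>x. h (u x)) \<in> L2 \<Omega>"
proof -
  obtain K where K: "\<And>x. norm (h x) \<le> norm x * K"
    using bounded_linear.bounded[OF assms(1)] by blast
  have m: "(\<lambda>x. h (u x)) \<in> borel_measurable (lebesgue_on \<Omega>)"
    using measurable_compose[OF L2_measurable[OF assms(2)]]
      borel_measurable_continuous_onI[OF linear_continuous_on[OF assms(1)]] by blast
  have "integrable (lebesgue_on \<Omega>) (\<lambda>x. (norm (u x))\<^sup>2 * K\<^sup>2)"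
    using assms(2)[THEN L2_integrable] by simp
  moreover have "(norm (h x))\<^sup>2 \<le> (norm x)\<^sup>2 * K\<^sup>2" for x
    using power_mono[OF K[of x] norm_ge_zero, of 2] by (simp add: power_mult_distrib)
  ultimately have "integrable (lebesgue_on \<Omega>) (\<lambda>x. (norm (h (u x)))\<^sup>2)"
    using m by (elim Bochner_Integration.integrable_bound) simp_all
  with m show ?thesis
    by (simp add: L2_def)
qed

text \<open>By boundedness and Young's inequality the product is dominated by a multiple of the two
  squared norms. A general bilinear map covers at once the inner product, the scaling by a test
  function and the symbols of the differential operators.\<close>

lemma integrable_bilinear_L2:
  fixes \<sigma> :: "'b::euclidean_space \<Rightarrow> 'c::euclidean_space \<Rightarrow> 'd::euclidean_space"
  assumes "bounded_bilinear \<sigma>" "u \<in> L2 \<Omega>" "v \<in> L2 \<Omega>"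
  shows "integrable (lebesgue_on \<Omega>) (\<lambda>x. \<sigma> (u x) (v x))"
proof -
  obtain K where K: "K \<ge> 0" "\<And>x y. norm (\<sigma> x y) \<le> norm x * norm y * K"
    using bounded_bilinear.nonneg_bounded[OF assms(1)] by blast
  have "continuous_on UNIV (\<lambda>z. \<sigma> (fst z) (snd z))"
    by (intro bounded_bilinear.continuous_on[OF assms(1)] continuous_intros)
  then have m: "(\<lambda>x. \<sigma> (u x) (v x)) \<in> borel_measurable (lebesgue_on \<Omega>)"
    by (rule borel_measurable_continuous_Pair[OF assms(2,3)[THEN L2_measurable]])
  have i: "integrable (lebesgue_on \<Omega>) (\<lambda>x. ((norm (u x))\<^sup>2 + (norm (v x))\<^sup>2) * K)"
    using assms(2,3)[THEN L2_integrable] by simp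
  have "norm (\<sigma> (u x) (v x)) \<le> ((norm (u x))\<^sup>2 + (norm (v x))\<^sup>2) * K" for x
  proof -
    have "norm (u x) * norm (v x) \<le> (norm (u x))\<^sup>2 + (norm (v x))\<^sup>2"
      using sum_squares_bound[of "norm (u x)" "norm (v x)"]
        mult_nonneg_nonneg[OF norm_ge_zero[of "u x"] norm_ge_zero[of "v x"]] by linarith
    then have "norm (u x) * norm (v x) * K \<le> ((norm (u x))\<^sup>2 + (norm (v x))\<^sup>2) * K"
      using K(1) by (rule mult_right_mono)
    with K(2) show ?thesis
      by (rule order_trans)
  qed
  then have "norm (\<sigma> (u x) (v x)) \<le> norm (((norm (u x))\<^sup>2 + (norm (v x))\<^sup>2) * K)" for x
    using K(1) by simp
  then show ?thesis
    by (intro Bochner_Integration.integrable_bound[OF i m] AE_I2)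
qed

section \<open>Algebra of the inner products\<close>

lemma l2_inner_commute: "\<langle>u, v\<rangle>\<^bsub>\<Omega>\<^esub> = \<langle>v, u\<rangle>\<^bsub>\<Omega>\<^esub>"
  by (simp add: l2_inner_def inner_commute)

lemma l2_inner_weighted_eq: "\<langle>u, v\<rangle>\<^bsub>\<Omega>,\<alpha>\<^esub> = \<alpha> * \<langle>u, v\<rangle>\<^bsub>\<Omega>\<^esub>"
  by (simp add: l2_inner_def l2_inner_weighted_def)

text \<open>In the denominator, \<tau> stems from the quotient and 2 from the average. Membership in
  \<open>L2\<close> allows the integral of the difference to be split.\<close>

lemma l2_inner_diff_quot_avg:
  assumes "u \<in> L2 \<Omega>" "v \<in> L2 \<Omega>"
  shows "\<langle>diff_quot \<tau> u v, avg u v\<rangle>\<^bsub>\<Omega>\<^esub> = (\<langle>u, u\<rangle>\<^bsub>\<Omega>\<^esub> - \<langle>v, v\<rangle>\<^bsub>\<Omega>\<^esub>) / (2 * \<tau>)"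
proof -
  have "diff_quot \<tau> u v x \<bullet> avg u v x = (u x \<bullet> u x - v x \<bullet> v x) / (2 * \<tau>)" for x
    by (simp add: diff_quot_def avg_def inner_diff_left inner_add_right inner_diff_right inner_commute[of "v x" "u x"]
        diff_divide_distrib)
  then show ?thesis
    using assms by (simp add: l2_inner_def integrable_bilinear_L2[OF bounded_bilinear_inner])
qed

section \<open>Test functions\<close>

lemma frechet_derivative_lincomb:
  assumes "f differentiable (at x)" "g differentiable (at x)"
  shows "frechet_derivative (\<lambda>x. a *\<^sub>R f x + b *\<^sub>R g x) (at x) h =
    a *\<^sub>R frechet_derivative f (at x) h + b *\<^sub>R frechet_derivative g (at x) h"
proof -
  have "((\<lambda>x. a *\<^sub>R f x + b *\<^sub>R g x) has_derivative
     (\<lambda>h. a *\<^sub>R frechet_derivative f (at x) h + b *\<^sub>R frechet_derivative g (at x) h)) (at x)"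
    using assms by (intro derivative_intros) (simp_all add: frechet_derivative_works[symmetric])
  from fun_cong[OF frechet_derivative_at[OF this], of h] show ?thesis
    by simp
qed

lemma Ck_lincomb: "Ck k f \<Longrightarrow> Ck k g \<Longrightarrow> Ck k (\<lambda>x. a *\<^sub>R f x + b *\<^sub>R g x)"
proof (induction k arbitrary: f g)
  case 0
  then show ?case by (simp add: continuous_on_add continuous_on_scaleR)
next
  case (Suc k)
  \<comment> \<open>Linearity of \<open>frechet_derivative\<close> is available only where both
    derivatives exist, so differentiability is secured before the partial derivatives are
    rewritten.\<close>
  then have d: "f differentiable (at x)" "g differentiable (at x)" for x
    by (simp_all add: differentiable_on_def)
  then have "(\<lambda>x. a *\<^sub>R f x + b *\<^sub>R g x) differentiable (at x)" for x
    by simp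
  with Suc d show ?case
    by (simp add: frechet_derivative_lincomb differentiable_on_def)
qed

lemma compact_closure_subset:
  fixes A B :: "'a::heine_borel set"
  shows "compact B \<Longrightarrow> closure A \<subseteq> B \<Longrightarrow> compact (closure A)"
  by (meson bounded_subset closed_closure compact_eq_bounded_closed)

lemma test_functions_lincomb:
  assumes "f \<in> test_functions \<Omega>" "g \<in> test_functions \<Omega>"
  shows "(\<lambda>x. a *\<^sub>R f x + b *\<^sub>R g x) \<in> test_functions \<Omega>"
proof -
  have "{x. a *\<^sub>R f x + b *\<^sub>R g x \<noteq> 0} \<subseteq> {x. f x \<noteq> 0} \<union> {x. g x \<noteq> 0}"
    by auto
  then have *: "closure {x. a *\<^sub>R f x + b *\<^sub>R g x \<noteq> 0} \<subseteq>
      closure {x. f x \<noteq> 0} \<union> closure {x. g x \<noteq> 0}"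
    unfolding closure_Un[symmetric] by (rule closure_mono)
  then have "compact (closure {x. a *\<^sub>R f x + b *\<^sub>R g x \<noteq> 0})"
    by (rule compact_closure_subset[OF compact_Un, rotated 2])
      (use assms in \<open>simp_all add: test_functions_def\<close>)
  moreover have "closure {x. a *\<^sub>R f x + b *\<^sub>R g x \<noteq> 0} \<subseteq> \<Omega>"
    using * assms by (auto simp: test_functions_def)
  moreover have "Ck k (\<lambda>x. a *\<^sub>R f x + b *\<^sub>R g x)" for k
    using assms by (simp add: test_functions_def Ck_lincomb)
  ultimately show ?thesis
    by (simp add: test_functions_def)
qed

lemma test_functions_differentiable: "f \<in> test_functions \<Omega> \<Longrightarrow> f differentiable (at x)"
  unfolding test_functions_def using Ck.simps(2)[of 0 f] by (auto simp: differentiable_on_def)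

text \<open>This reduces square integrability of the classical operators to that of test
  functions.\<close>

lemma test_functions_partial:
  assumes "f \<in> test_functions \<Omega>" "b \<in> Basis"
  shows "(\<lambda>x. frechet_derivative f (at x) b) \<in> test_functions \<Omega>"
proof -
  \<comment> \<open>The complement of the support is open and \<open>f\<close> vanishes on it, hence
    so does its derivative.\<close>
  have z: "frechet_derivative f (at x) b = 0" if "x \<notin> closure {x. f x \<noteq> 0}" for x
  proof -
    have "(f has_derivative (\<lambda>_. 0)) (at x)"
      by (rule has_derivative_transform_within_open[of "\<lambda>_. 0" _ _ _ "- closure {x. f x \<noteq> 0}"])
        (use that closure_subset[of "{x. f x \<noteq> 0}"] in auto)
    from fun_cong[OF frechet_derivative_at[OF this], of b] show ?thesis
      by simp
  qed
  then have "closure {x. frechet_derivative f (at x) b \<noteq> 0} \<subseteq> closure {x. f x \<noteq> 0}"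
    by (intro closure_minimal) auto
  moreover have "Ck k (\<lambda>x. frechet_derivative f (at x) b)" for k
    using assms Ck.simps(2)[of k f] by (simp add: test_functions_def)
  ultimately show ?thesis
    using assms compact_closure_subset unfolding test_functions_def by blast
qed

lemma test_functions_L2:
  fixes f :: "'a::euclidean_space \<Rightarrow> 'b::euclidean_space"
  assumes "f \<in> test_functions \<Omega>" "open \<Omega>"
  shows "f \<in> L2 \<Omega>"
proof -
  let ?K = "closure {x. f x \<noteq> 0}"
  have c: "continuous_on UNIV f"
    using assms(1) Ck.simps(1)[of f] unfolding test_functions_def by blast
  have K: "compact ?K"
    using assms(1) by (simp add: test_functions_def)
  \<comment> \<open>A continuous function is integrable over a compact set. The indicator of the
    support does not alter the integrand, which is 0 elsewhere.\<close>
  have "integrable lborel (\<lambda>x. indicator ?K x *\<^sub>R (norm (f x))\<^sup>2)"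
    by (rule borel_integrable_compact[OF K])
      (intro continuous_intros continuous_on_subset[OF c], simp)
  moreover have "indicator ?K x *\<^sub>R (norm (f x))\<^sup>2 = (norm (f x))\<^sup>2" for x
    using closure_subset[of "{x. f x \<noteq> 0}"] by (auto simp: indicator_def)
  ultimately have "integrable lborel (\<lambda>x. (norm (f x))\<^sup>2)"
    by (simp only:)
  \<comment> \<open>Pass to the completed measure first and then restrict to \<Omega>, which is
    measurable because it is open.\<close>
  then have "integrable lebesgue (\<lambda>x. (norm (f x))\<^sup>2)"
    by (simp add: integrable_completion borel_measurable_continuous_onI c continuous_on_norm continuous_on_power)
  then have "integrable (lebesgue_on \<Omega>) (\<lambda>x. (norm (f x))\<^sup>2)"
    using assms(2) integrable_mult_indicator[of \<Omega> lebesgue]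
    by (simp add: integrable_restrict_space borel_open del: real_scaleR_def)
  moreover have "f \<in> borel_measurable (lebesgue_on \<Omega>)"
    using borel_measurable_continuous_onI[OF c]
    by (intro measurable_restrict_space1 measurable_completion) simp
  ultimately show ?thesis
    by (simp add: L2_def)
qed

section \<open>Sobolev spaces\<close>

lemma classical_op_lincomb:
  assumes "bounded_bilinear \<sigma>" "f differentiable (at x)" "g differentiable (at x)"
  shows "classical_op \<sigma> (\<lambda>x. a *\<^sub>R f x + b *\<^sub>R g x) x = a *\<^sub>R classical_op \<sigma> f x + b *\<^sub>R classical_op \<sigma> g x"
  using assms
  by (simp add: classical_op_def frechet_derivative_lincomb bounded_bilinear.add_right
      bounded_bilinear.scaleR_right sum.distrib scaleR_sum_right)

lemma classical_op_L2:
  assumes "bounded_bilinear \<sigma>" "f \<in> test_functions \<Omega>" "open \<Omega>"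
  shows "classical_op \<sigma> f \<in> L2 \<Omega>"
proof -
  have "(\<lambda>x. \<sigma> b (frechet_derivative f (at x) b)) \<in> L2 \<Omega>" if "b \<in> Basis" for b
    by (rule L2_bounded_linear[OF bounded_bilinear.bounded_linear_right[OF assms(1)]
          test_functions_L2[OF test_functions_partial[OF assms(2) that] assms(3)]])
  then show ?thesis
    unfolding classical_op_def by (rule L2_sum)
qed

lemma bounded_bilinear_grad_symb: "bounded_bilinear grad_symb"
  unfolding grad_symb_def [abs_def]
  by (rule bounded_bilinear.flip[OF bounded_bilinear_scaleR])

lemma bounded_bilinear_div_symb: "bounded_bilinear div_symb"
  unfolding div_symb_def [abs_def] by (rule bounded_bilinear_inner)

lemma bounded_bilinear_cross3: "bounded_bilinear cross3"
  using bilinear_cross by (simp add: bilinear_conv_bounded_bilinear)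

text \<open>In finite dimensions bilinearity implies boundedness, so checking the algebraic laws in
  coordinates suffices.\<close>

lemma bounded_bilinear_rot2: "bounded_bilinear rot2"
  by (simp add: bilinear_conv_bounded_bilinear[symmetric] bilinear_def linear_iff rot2_def algebra_simps)

lemma bounded_bilinear_vrot2: "bounded_bilinear vrot2"
  by (simp add: bilinear_conv_bounded_bilinear[symmetric] bilinear_def linear_iff vrot2_def
      vec_eq_iff forall_2 algebra_simps)

text \<open>The integration by parts identity is linear in the pair of field and image. The relation
  is used instead of the chosen \<open>weak_op\<close>, since membership in the Sobolev spaces asks
  only for some image.\<close>

lemma has_weak_op_lincomb:
  assumes "bounded_bilinear \<sigma>" "open \<Omega>" "has_weak_op \<Omega> \<sigma> u u'" "has_weak_op \<Omega> \<sigma> v v'"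
  shows "has_weak_op \<Omega> \<sigma> (\<lambda>x. a *\<^sub>R u x + b *\<^sub>R v x) (\<lambda>x. a *\<^sub>R u' x + b *\<^sub>R v' x)"
proof -
  have L: "u \<in> L2 \<Omega>" "v \<in> L2 \<Omega>" "u' \<in> L2 \<Omega>" "v' \<in> L2 \<Omega>"
    using assms(3,4) by (simp_all add: has_weak_op_def)
  have "(LINT x|lebesgue_on \<Omega>. \<phi> x *\<^sub>R (a *\<^sub>R u' x + b *\<^sub>R v' x)) =
      - (LINT x|lebesgue_on \<Omega>. \<sigma> (classical_op grad_symb \<phi> x) (a *\<^sub>R u x + b *\<^sub>R v x))"
    if \<phi>: "\<phi> \<in> test_functions \<Omega>" for \<phi>
  proof -
    \<comment> \<open>The integral of a non-integrable function defaults to 0, so splitting the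
      integrals requires each product to be integrable; each is bilinear in two \<open>L2\<close>
      fields.\<close>
    note i1 = integrable_bilinear_L2[OF bounded_bilinear_scaleR test_functions_L2[OF \<phi> assms(2)]]
    note i2 = integrable_bilinear_L2[OF assms(1) classical_op_L2[OF bounded_bilinear_grad_symb \<phi> assms(2)]]
    have "(LINT x|lebesgue_on \<Omega>. \<phi> x *\<^sub>R (a *\<^sub>R u' x + b *\<^sub>R v' x)) =
      (LINT x|lebesgue_on \<Omega>. a *\<^sub>R (\<phi> x *\<^sub>R u' x) + b *\<^sub>R (\<phi> x *\<^sub>R v' x))"
      by (simp add: scaleR_right_distrib mult.commute)
    also have "\<dots> = a *\<^sub>R (LINT x|lebesgue_on \<Omega>. \<phi> x *\<^sub>R u' x) + b *\<^sub>R (LINT x|lebesgue_on \<Omega>. \<phi> x *\<^sub>R v' x)"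
      using L by (simp add: i1 del: scaleR_scaleR)
    also have "\<dots> = - (a *\<^sub>R (LINT x|lebesgue_on \<Omega>. \<sigma> (classical_op grad_symb \<phi> x) (u x)) +
        b *\<^sub>R (LINT x|lebesgue_on \<Omega>. \<sigma> (classical_op grad_symb \<phi> x) (v x)))"
      using assms(3,4) \<phi> by (simp add: has_weak_op_def)
    also have "\<dots> = - (LINT x|lebesgue_on \<Omega>. a *\<^sub>R \<sigma> (classical_op grad_symb \<phi> x) (u x) +
        b *\<^sub>R \<sigma> (classical_op grad_symb \<phi> x) (v x))"
      using L by (simp add: i2 del: scaleR_scaleR)
    finally show ?thesis
      by (simp add: bounded_bilinear.add_right[OF assms(1)] bounded_bilinear.scaleR_right[OF assms(1)])
  qed
  with L show ?thesis
    by (simp add: has_weak_op_def L2_lincomb)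
qed

text \<open>A squeeze between 0 and a combination of the two given null sequences. It is applied
  both to approximating test functions and to their images under the operator.\<close>

lemma L2_convergent_lincomb:
  assumes "\<And>k. f k \<in> L2 \<Omega>" "\<And>k. g k \<in> L2 \<Omega>" "u \<in> L2 \<Omega>" "v \<in> L2 \<Omega>"
    and "(\<lambda>k. LINT x|lebesgue_on \<Omega>. (norm (f k x - u x))\<^sup>2) \<longlonglongrightarrow> 0"
    and "(\<lambda>k. LINT x|lebesgue_on \<Omega>. (norm (g k x - v x))\<^sup>2) \<longlonglongrightarrow> 0"
  shows "(\<lambda>k. LINT x|lebesgue_on \<Omega>.
    (norm ((a *\<^sub>R f k x + b *\<^sub>R g k x) - (a *\<^sub>R u x + b *\<^sub>R v x)))\<^sup>2) \<longlonglongrightarrow> 0"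
    (is "?I \<longlonglongrightarrow> 0")
proof (rule tendsto_sandwich[of "\<lambda>_. 0"])
  let ?J = "\<lambda>k. 2 * a\<^sup>2 * (LINT x|lebesgue_on \<Omega>. (norm (f k x - u x))\<^sup>2)
    + 2 * b\<^sup>2 * (LINT x|lebesgue_on \<Omega>. (norm (g k x - v x))\<^sup>2)"
  have eq: "(a *\<^sub>R f k x + b *\<^sub>R g k x) - (a *\<^sub>R u x + b *\<^sub>R v x)
      = a *\<^sub>R (f k x - u x) + b *\<^sub>R (g k x - v x)" for k x
    by (simp add: algebra_simps)
  have L: "(\<lambda>x. f k x - u x) \<in> L2 \<Omega>" "(\<lambda>x. g k x - v x) \<in> L2 \<Omega>" for k
    using assms by (simp_all add: L2_diff)
  have "?I k \<le> ?J k" for k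
  proof -
    have "?I k \<le> (LINT x|lebesgue_on \<Omega>. 2 * a\<^sup>2 * (norm (f k x - u x))\<^sup>2 + 2 * b\<^sup>2 * (norm (g k x - v x))\<^sup>2)"
      unfolding eq
      using L[of k, THEN L2_integrable] L2_integrable[OF L2_lincomb[OF L]]
      by (intro integral_mono norm_lincomb_sq_le) simp_all
    then show ?thesis
      using L[of k, THEN L2_integrable] by simp
  qed
  then show "\<forall>\<^sub>F k in sequentially. ?I k \<le> ?J k" by simp
  show "?J \<longlonglongrightarrow> 0"
    using tendsto_add[OF tendsto_mult_right_zero[OF assms(5)] tendsto_mult_right_zero[OF assms(6)]] by simp
  show "\<forall>\<^sub>F k in sequentially. 0 \<le> ?I k" by simp
  show "(\<lambda>_. 0) \<longlonglongrightarrow> (0::real)" by simp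
qed

lemma sobolev_lincomb:
  assumes "bounded_bilinear \<sigma>" "open \<Omega>" "u \<in> sobolev \<Omega> \<sigma>" "v \<in> sobolev \<Omega> \<sigma>"
  shows "(\<lambda>x. a *\<^sub>R u x + b *\<^sub>R v x) \<in> sobolev \<Omega> \<sigma>"
  using assms has_weak_op_lincomb unfolding sobolev_def by blast

text \<open>The linear combination of the two approximating sequences approximates in the graph
  norm: one sequence serves for the field and for its image, because the classical operator is
  linear on differentiable functions.\<close>

lemma sobolev0_lincomb:
  assumes "bounded_bilinear \<sigma>" "open \<Omega>" "u \<in> sobolev0 \<Omega> \<sigma>" "v \<in> sobolev0 \<Omega> \<sigma>"
  shows "(\<lambda>x. a *\<^sub>R u x + b *\<^sub>R v x) \<in> sobolev0 \<Omega> \<sigma>"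
proof -
  obtain u' \<phi> where u: "has_weak_op \<Omega> \<sigma> u u'" "\<And>k::nat. \<phi> k \<in> test_functions \<Omega>"
    "(\<lambda>k. LINT x|lebesgue_on \<Omega>. (norm (\<phi> k x - u x))\<^sup>2) \<longlonglongrightarrow> 0"
    "(\<lambda>k. LINT x|lebesgue_on \<Omega>. (norm (classical_op \<sigma> (\<phi> k) x - u' x))\<^sup>2) \<longlonglongrightarrow> 0"
    using assms(3) by (auto simp: sobolev0_def)
  obtain v' \<psi> where v: "has_weak_op \<Omega> \<sigma> v v'" "\<And>k::nat. \<psi> k \<in> test_functions \<Omega>"
    "(\<lambda>k. LINT x|lebesgue_on \<Omega>. (norm (\<psi> k x - v x))\<^sup>2) \<longlonglongrightarrow> 0"
    "(\<lambda>k. LINT x|lebesgue_on \<Omega>. (norm (classical_op \<sigma> (\<psi> k) x - v' x))\<^sup>2) \<longlonglongrightarrow> 0"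
    using assms(4) by (auto simp: sobolev0_def)
  have L: "u \<in> L2 \<Omega>" "v \<in> L2 \<Omega>" "u' \<in> L2 \<Omega>" "v' \<in> L2 \<Omega>"
    using u(1) v(1) by (simp_all add: has_weak_op_def)
  let ?\<chi> = "\<lambda>k x. a *\<^sub>R \<phi> k x + b *\<^sub>R \<psi> k x"
  have "classical_op \<sigma> (?\<chi> k) x = a *\<^sub>R classical_op \<sigma> (\<phi> k) x + b *\<^sub>R classical_op \<sigma> (\<psi> k) x" for k x
    using assms(1) u(2) v(2) test_functions_differentiable by (blast intro: classical_op_lincomb)
  then have "(\<lambda>k. LINT x|lebesgue_on \<Omega>. (norm (classical_op \<sigma> (?\<chi> k) x - (a *\<^sub>R u' x + b *\<^sub>R v' x)))\<^sup>2) \<longlonglongrightarrow> 0"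
    using L2_convergent_lincomb[OF _ _ L(3,4) u(4) v(4)] classical_op_L2[OF assms(1) _ assms(2)] u(2) v(2)
    by simp
  moreover have "(\<lambda>k. LINT x|lebesgue_on \<Omega>. (norm (?\<chi> k x - (a *\<^sub>R u x + b *\<^sub>R v x)))\<^sup>2) \<longlonglongrightarrow> 0"
    using L2_convergent_lincomb[OF _ _ L(1,2) u(3) v(3)] test_functions_L2[OF _ assms(2)] u(2) v(2)
    by blast
  moreover have "?\<chi> k \<in> test_functions \<Omega>" for k
    using u(2) v(2) by (rule test_functions_lincomb)
  ultimately show ?thesis
    using has_weak_op_lincomb[OF assms(1,2) u(1) v(1), of a b]
    unfolding sobolev0_def by (intro CollectI exI[of _ "\<lambda>x. a *\<^sub>R u' x + b *\<^sub>R v' x"] conjI exI[of _ ?\<chi>]) auto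
qed

lemma sobolev0_L2: "u \<in> sobolev0 \<Omega> \<sigma> \<Longrightarrow> u \<in> L2 \<Omega>"
  by (auto simp: sobolev0_def has_weak_op_def)

section \<open>Averages as admissible test functions\<close>

lemma avg_eq_lincomb: "avg u v = (\<lambda>x. (1/2) *\<^sub>R u x + (1/2) *\<^sub>R v x)"
  by (simp add: avg_def scaleR_right_distrib)

lemma avg_L2: "u \<in> L2 \<Omega> \<Longrightarrow> v \<in> L2 \<Omega> \<Longrightarrow> avg u v \<in> L2 \<Omega>"
  unfolding avg_eq_lincomb by (rule L2_lincomb)

lemma avg_sobolev0:
  "bounded_bilinear \<sigma> \<Longrightarrow> open \<Omega> \<Longrightarrow> u \<in> sobolev0 \<Omega> \<sigma> \<Longrightarrow> v \<in> sobolev0 \<Omega> \<sigma> \<Longrightarrow>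
    avg u v \<in> sobolev0 \<Omega> \<sigma>"
  unfolding avg_eq_lincomb by (rule sobolev0_lincomb)

lemma avg_p_space: "open \<Omega> \<Longrightarrow> p \<in> p_space \<Omega> \<Longrightarrow> q \<in> p_space \<Omega> \<Longrightarrow> avg p q \<in> p_space \<Omega>"
  unfolding p_space_def by (intro avg_sobolev0 bounded_bilinear_grad_symb)

text \<open>The combination of the two divergences is a divergence of the average and again has a
  weak gradient.\<close>

lemma avg_E_space:
  assumes "bounded_bilinear \<kappa>" "open \<Omega>" "E \<in> E_space \<Omega> \<kappa>" "F \<in> E_space \<Omega> \<kappa>"
  shows "avg E F \<in> E_space \<Omega> \<kappa>"
  using assms(3,4) sobolev_lincomb[OF bounded_bilinear_grad_symb assms(2)]
    has_weak_op_lincomb[OF bounded_bilinear_div_symb assms(2)] sobolev0_lincomb[OF assms(1,2)]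
  unfolding E_space_def avg_eq_lincomb by blast

text \<open>The base space \<open>V\<close> is kept abstract because it differs with the dimension:
  \<open>sobolev0\<close> for the divergence in space, \<open>L2\<close> in the plane.\<close>

lemma avg_H_space:
  assumes "bounded_bilinear \<kappa>" "bounded_bilinear \<kappa>'" "open \<Omega>"
    and "\<And>u v. u \<in> V \<Longrightarrow> v \<in> V \<Longrightarrow> avg u v \<in> V"
    and "G \<in> H_space \<Omega> \<kappa> \<kappa>' V" "H \<in> H_space \<Omega> \<kappa> \<kappa>' V"
  shows "avg G H \<in> H_space \<Omega> \<kappa> \<kappa>' V"
  using assms(4-6) sobolev_lincomb[OF assms(1,3)] has_weak_op_lincomb[OF assms(2,3)]
  unfolding H_space_def avg_eq_lincomb by blast

section \<open>Energy balance\<close>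

lemma energy_lf4_step:
  assumes "0 < \<epsilon>" "0 < \<tau>"
    and "p \<in> L2 \<Omega>" "p' \<in> L2 \<Omega>" "avg p' p \<in> p_space \<Omega>"
    and "E \<in> L2 \<Omega>" "E' \<in> L2 \<Omega>" "avg E' E \<in> E_space \<Omega> \<kappa>"
    and "H \<in> L2 \<Omega>" "H' \<in> L2 \<Omega>" "avg H' H \<in> HV"
    and "lf4_step \<Omega> \<kappa> \<kappa>' HV \<epsilon> \<mu> \<tau> p E H p' E' H'"
  shows "energy \<Omega> \<epsilon> \<mu> p' E' H' = energy \<Omega> \<epsilon> \<mu> p E H"
proof -
  let ?p = "avg p' p" and ?E = "avg E' E" and ?H = "avg H' H"
  \<comment> \<open>\<open>?A\<close> couples p with E and \<open>?B\<close> couples E with H. The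
    three tested equations give \<epsilon> times \<open>?A\<close>, then \<open>?B - ?A\<close>,
    then \<open>- ?B\<close>.\<close>
  let ?A = "\<langle>grad \<Omega> ?p, ?E\<rangle>\<^bsub>\<Omega>\<^esub> - \<tau>\<^sup>2 / 12 * \<langle>grad \<Omega> ?p, grad \<Omega> (diverg \<Omega> ?E)\<rangle>\<^bsub>\<Omega>\<^esub>"
  let ?B = "\<langle>?H, weak_op \<Omega> \<kappa> ?E\<rangle>\<^bsub>\<Omega>\<^esub>
    + \<tau>\<^sup>2 / 12 * (1 / (\<mu> * \<epsilon>) * \<langle>weak_op \<Omega> \<kappa> (weak_op \<Omega> \<kappa>' ?H), weak_op \<Omega> \<kappa> ?E\<rangle>\<^bsub>\<Omega>\<^esub>)"
  have "\<langle>diff_quot \<tau> p' p, ?p\<rangle>\<^bsub>\<Omega>\<^esub> = \<epsilon> * ?A"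
    using assms(5,12)
    by (simp add: lf4_step_def Let_def l2_inner_weighted_eq l2_inner_commute[of "grad \<Omega> ?p"] algebra_simps)
  moreover have "\<epsilon> * \<langle>diff_quot \<tau> E' E, ?E\<rangle>\<^bsub>\<Omega>\<^esub> = ?B - ?A"
    using bspec[OF conjunct1[OF conjunct2[OF assms(12)[unfolded lf4_step_def Let_def]]] assms(8)]
    by (simp add: l2_inner_weighted_eq)
  moreover have "\<mu> * \<langle>diff_quot \<tau> H' H, ?H\<rangle>\<^bsub>\<Omega>\<^esub> = - ?B"
    using bspec[OF conjunct2[OF conjunct2[OF assms(12)[unfolded lf4_step_def Let_def]]] assms(11)]
    by (simp add: l2_inner_weighted_eq l2_inner_commute[of "weak_op \<Omega> \<kappa> ?E"] mult.commute[of \<epsilon> \<mu>])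
  \<comment> \<open>The factor \<open>1 / \<epsilon>\<close>, which makes the sum vanish, is exactly
    the weight of p in the energy.\<close>
  ultimately have "1 / \<epsilon> * \<langle>diff_quot \<tau> p' p, ?p\<rangle>\<^bsub>\<Omega>\<^esub> + \<epsilon> * \<langle>diff_quot \<tau> E' E, ?E\<rangle>\<^bsub>\<Omega>\<^esub>
      + \<mu> * \<langle>diff_quot \<tau> H' H, ?H\<rangle>\<^bsub>\<Omega>\<^esub> = 0"
    using assms(1) by simp
  then have "(energy \<Omega> \<epsilon> \<mu> p' E' H' - energy \<Omega> \<epsilon> \<mu> p E H) / (2 * \<tau>) = 0"
    unfolding l2_inner_diff_quot_avg[OF assms(4,3)] l2_inner_diff_quot_avg[OF assms(7,6)]
      l2_inner_diff_quot_avg[OF assms(10,9)] energy_def l2_inner_weighted_eq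
    by (simp add: add_divide_distrib diff_divide_distrib algebra_simps)
  then show ?thesis
    using assms(2) by simp
qed

text \<open>The \<open>H\<close> equation is weighted twice: its coupling terms carry half the factors of those in the
  \<open>E\<close> equation, while \<open>H\<close> advances by twice the step of \<open>p\<close> and \<open>E\<close>.\<close>

lemma energy_lf4_bootstrap:
  assumes "0 < \<epsilon>" "0 < \<tau>"
    and "p \<in> L2 \<Omega>" "p' \<in> L2 \<Omega>" "avg p' p \<in> p_space \<Omega>"
    and "E \<in> L2 \<Omega>" "E' \<in> L2 \<Omega>" "avg E' E \<in> E_space \<Omega> \<kappa>"
    and "H \<in> L2 \<Omega>" "H' \<in> L2 \<Omega>" "avg H' H \<in> HV"
    and "lf4_bootstrap \<Omega> \<kappa> \<kappa>' HV \<epsilon> \<mu> \<tau> p E H p' E' H'"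
  shows "energy \<Omega> \<epsilon> \<mu> p' E' H' = energy \<Omega> \<epsilon> \<mu> p E H"
proof -
  let ?p = "avg p' p" and ?E = "avg E' E" and ?H = "avg H' H"
  let ?A = "1/2 * \<langle>grad \<Omega> ?p, ?E\<rangle>\<^bsub>\<Omega>\<^esub> - 1/8 * (\<tau>\<^sup>2 / 12) * \<langle>grad \<Omega> ?p, grad \<Omega> (diverg \<Omega> ?E)\<rangle>\<^bsub>\<Omega>\<^esub>"
  let ?B = "\<langle>?H, weak_op \<Omega> \<kappa> ?E\<rangle>\<^bsub>\<Omega>\<^esub>
    + 1/4 * (\<tau>\<^sup>2 / 12) * (1 / (\<mu> * \<epsilon>) * \<langle>weak_op \<Omega> \<kappa> (weak_op \<Omega> \<kappa>' ?H), weak_op \<Omega> \<kappa> ?E\<rangle>\<^bsub>\<Omega>\<^esub>)"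
  have "\<langle>diff_quot (\<tau>/2) p' p, ?p\<rangle>\<^bsub>\<Omega>\<^esub> = \<epsilon> * ?A"
    using assms(5,12)
    by (simp add: lf4_bootstrap_def Let_def l2_inner_weighted_eq l2_inner_commute[of "grad \<Omega> ?p"] algebra_simps)
  moreover have "\<epsilon> * \<langle>diff_quot (\<tau>/2) E' E, ?E\<rangle>\<^bsub>\<Omega>\<^esub> = ?B - ?A"
    using bspec[OF conjunct1[OF conjunct2[OF assms(12)[unfolded lf4_bootstrap_def Let_def]]] assms(8)]
    by (simp add: l2_inner_weighted_eq)
  moreover have "2 * (\<mu> * \<langle>diff_quot \<tau> H' H, ?H\<rangle>\<^bsub>\<Omega>\<^esub>) = - ?B"
    using bspec[OF conjunct2[OF conjunct2[OF assms(12)[unfolded lf4_bootstrap_def Let_def]]] assms(11)]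
    by (simp add: l2_inner_weighted_eq l2_inner_commute[of "weak_op \<Omega> \<kappa> ?E"] mult.commute[of \<epsilon> \<mu>])
  ultimately have "1 / \<epsilon> * \<langle>diff_quot (\<tau>/2) p' p, ?p\<rangle>\<^bsub>\<Omega>\<^esub> + \<epsilon> * \<langle>diff_quot (\<tau>/2) E' E, ?E\<rangle>\<^bsub>\<Omega>\<^esub>
      + 2 * (\<mu> * \<langle>diff_quot \<tau> H' H, ?H\<rangle>\<^bsub>\<Omega>\<^esub>) = 0"
    using assms(1) by simp
  \<comment> \<open>The divisor is \<tau>, not twice \<tau> as in the general step: p and E
    contribute twice their half step, and the doubling of the H term cancels its 2.\<close>
  then have "(energy \<Omega> \<epsilon> \<mu> p' E' H' - energy \<Omega> \<epsilon> \<mu> p E H) / \<tau> = 0"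
    unfolding l2_inner_diff_quot_avg[OF assms(4,3)] l2_inner_diff_quot_avg[OF assms(7,6)]
      l2_inner_diff_quot_avg[OF assms(10,9)] energy_def l2_inner_weighted_eq
    by (simp add: add_divide_distrib diff_divide_distrib algebra_simps)
  then show ?thesis
    using assms(2) by simp
qed

lemma energy_lf4_solution:
  assumes "0 < \<epsilon>" "0 < \<tau>" "open \<Omega>" "bounded_bilinear \<kappa>" "0 < N"
    and HV: "HV \<subseteq> L2 \<Omega>" "\<And>u v. u \<in> HV \<Longrightarrow> v \<in> HV \<Longrightarrow> avg u v \<in> HV"
    and "p0 \<in> p_space \<Omega>" "E0 \<in> E_space \<Omega> \<kappa>" "H0 \<in> HV"
    and sol: "lf4_solution \<Omega> \<kappa> \<kappa>' HV \<epsilon> \<mu> \<tau> N p0 E0 H0 p E H"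
  shows "energy \<Omega> \<epsilon> \<mu> (p (N - 1)) (E (N - 1)) (H N) = energy \<Omega> \<epsilon> \<mu> p0 E0 H0"
proof -
  note avg = avg_p_space[OF assms(3)] avg_E_space[OF assms(4,3)] HV(2)
  have L: "\<And>q. q \<in> p_space \<Omega> \<Longrightarrow> q \<in> L2 \<Omega>" "\<And>F. F \<in> E_space \<Omega> \<kappa> \<Longrightarrow> F \<in> L2 \<Omega>"
    "\<And>G. G \<in> HV \<Longrightarrow> G \<in> L2 \<Omega>"
    using HV(1) sobolev0_L2 by (auto simp: p_space_def E_space_def)
  have S: "p n \<in> p_space \<Omega>" "E n \<in> E_space \<Omega> \<kappa>" "H (Suc n) \<in> HV" if "n < N" for n
    using sol that by (simp_all add: lf4_solution_def)
  \<comment> \<open>The state with index n pairs p and E at time \<open>(n + 1/2) * \<tau>\<close>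
    with H at time \<open>(n + 1) * \<tau>\<close>; index 0 is the outcome of the bootstrap.\<close>
  have "energy \<Omega> \<epsilon> \<mu> (p n) (E n) (H (Suc n)) = energy \<Omega> \<epsilon> \<mu> p0 E0 H0" if "n < N" for n
    using that
  proof (induction n)
    case 0
    have "lf4_bootstrap \<Omega> \<kappa> \<kappa>' HV \<epsilon> \<mu> \<tau> p0 E0 H0 (p 0) (E 0) (H (Suc 0))"
      using sol by (simp add: lf4_solution_def)
    from energy_lf4_bootstrap[OF assms(1,2) L(1) L(1) avg(1) L(2) L(2) avg(2) L(3) L(3) avg(3) this]
    show ?case
      using assms(8-10) S[OF 0] by simp
  next
    case (Suc n)
    then have n: "n < N" by simp
    \<comment> \<open>The general step is instantiated at \<open>Suc n\<close>, whose predecessor is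
      n.\<close>
    have "lf4_step \<Omega> \<kappa> \<kappa>' HV \<epsilon> \<mu> \<tau> (p n) (E n) (H (Suc n)) (p (Suc n)) (E (Suc n)) (H (Suc (Suc n)))"
      using sol[unfolded lf4_solution_def, THEN conjunct2, THEN conjunct2, THEN bspec, of "Suc n"] Suc.prems
      by simp
    from energy_lf4_step[OF assms(1,2) L(1) L(1) avg(1) L(2) L(2) avg(2) L(3) L(3) avg(3) this]
    have "energy \<Omega> \<epsilon> \<mu> (p (Suc n)) (E (Suc n)) (H (Suc (Suc n))) =
        energy \<Omega> \<epsilon> \<mu> (p n) (E n) (H (Suc n))"
      using S[OF n] S[OF Suc.prems] by simp
    with Suc.IH n show ?case by simp
  qed
  \<comment> \<open>Positivity of N turns \<open>Suc (N - 1)\<close> into N and places the last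
    index in range.\<close>
  from this[of "N - 1"] show ?thesis
    using assms(5) by simp
qed

section \<open>Conservation in space and in the plane\<close>

theorem theorem3:
  fixes \<epsilon> \<mu> T :: real and \<Omega>3 :: "(real^3) set" and \<Omega>2 :: "(real^2) set"
  assumes "0 < \<epsilon>" and "0 < \<mu>" and "0 < T"
    and "lipschitz_domain \<Omega>3" and "lipschitz_domain \<Omega>2"
  shows
    "(\<exists>\<delta>>0. \<forall>\<tau> N p0 E0 H0 p E H.
        0 < \<tau> \<and> \<tau> < \<delta> \<and> \<bar>real N * \<tau> - T\<bar> \<le> \<tau> \<and>
        p0 \<in> p_space \<Omega>3 \<and> E0 \<in> E_space3 \<Omega>3 \<and> H0 \<in> H_space3 \<Omega>3 \<and>
        has_weak_op \<Omega>3 div_symb (\<lambda>x. \<epsilon> *\<^sub>R E0 x) p0 \<and>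
        has_weak_op \<Omega>3 div_symb (\<lambda>x. \<mu> *\<^sub>R H0 x) (\<lambda>x. 0) \<and>
        lf4_solution3 \<Omega>3 \<epsilon> \<mu> \<tau> N p0 E0 H0 p E H \<longrightarrow>
        energy \<Omega>3 \<epsilon> \<mu> (p (N - 1)) (E (N - 1)) (H N) = energy \<Omega>3 \<epsilon> \<mu> p0 E0 H0) \<and>
     (\<exists>\<delta>>0. \<forall>\<tau> N p0 E0 H0 p E H.
        0 < \<tau> \<and> \<tau> < \<delta> \<and> \<bar>real N * \<tau> - T\<bar> \<le> \<tau> \<and>
        p0 \<in> p_space \<Omega>2 \<and> E0 \<in> E_space2 \<Omega>2 \<and> H0 \<in> H_space2 \<Omega>2 \<and>
        has_weak_op \<Omega>2 div_symb (\<lambda>x. \<epsilon> *\<^sub>R E0 x) p0 \<and>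
        lf4_solution2 \<Omega>2 \<epsilon> \<mu> \<tau> N p0 E0 H0 p E H \<longrightarrow>
        energy \<Omega>2 \<epsilon> \<mu> (p (N - 1)) (E (N - 1)) (H N) = energy \<Omega>2 \<epsilon> \<mu> p0 E0 H0)"
proof (intro conjI exI[of _ T] allI impI)
  have o: "open \<Omega>3" "open \<Omega>2"
    using assms by (simp_all add: lipschitz_domain_def)
  \<comment> \<open>For \<open>N = 0\<close> the grid condition would read
    \<open>T \<le> \<tau>\<close>, contradicting \<open>\<tau> < T\<close>; hence the choice of T as
    the bound on the time step. \<open>X\<close> stands for the remaining hypotheses.\<close>
  have N: "0 < N" if "0 < \<tau> \<and> \<tau> < T \<and> \<bar>real N * \<tau> - T\<bar> \<le> \<tau> \<and> X" for \<tau> N X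
    using that by (cases N) auto
  {
    fix \<tau> N p0 E0 H0 p E H
    assume *: "0 < \<tau> \<and> \<tau> < T \<and> \<bar>real N * \<tau> - T\<bar> \<le> \<tau> \<and>
        p0 \<in> p_space \<Omega>3 \<and> E0 \<in> E_space3 \<Omega>3 \<and> H0 \<in> H_space3 \<Omega>3 \<and>
        has_weak_op \<Omega>3 div_symb (\<lambda>x. \<epsilon> *\<^sub>R E0 x) p0 \<and>
        has_weak_op \<Omega>3 div_symb (\<lambda>x. \<mu> *\<^sub>R H0 x) (\<lambda>x. 0) \<and>
        lf4_solution3 \<Omega>3 \<epsilon> \<mu> \<tau> N p0 E0 H0 p E H"
    have sub: "H_space3 \<Omega>3 \<subseteq> L2 \<Omega>3"
      using sobolev0_L2 by (auto simp: H_space_def)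
    note avg = avg_H_space[OF bounded_bilinear_cross3 bounded_bilinear_cross3 o(1)
        avg_sobolev0[OF bounded_bilinear_div_symb o(1)]]
    show "energy \<Omega>3 \<epsilon> \<mu> (p (N - 1)) (E (N - 1)) (H N) = energy \<Omega>3 \<epsilon> \<mu> p0 E0 H0"
      using * by (intro energy_lf4_solution[where \<tau> = \<tau> and \<kappa>' = cross3,
            OF assms(1) _ o(1) bounded_bilinear_cross3 N[OF *] sub avg]) blast+
  }
  {
    fix \<tau> N p0 E0 H0 p E H
    assume *: "0 < \<tau> \<and> \<tau> < T \<and> \<bar>real N * \<tau> - T\<bar> \<le> \<tau> \<and>
        p0 \<in> p_space \<Omega>2 \<and> E0 \<in> E_space2 \<Omega>2 \<and> H0 \<in> H_space2 \<Omega>2 \<and>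
        has_weak_op \<Omega>2 div_symb (\<lambda>x. \<epsilon> *\<^sub>R E0 x) p0 \<and>
        lf4_solution2 \<Omega>2 \<epsilon> \<mu> \<tau> N p0 E0 H0 p E H"
    have sub: "H_space2 \<Omega>2 \<subseteq> L2 \<Omega>2"
      by (auto simp: H_space_def)
    note avg = avg_H_space[OF bounded_bilinear_rot2 bounded_bilinear_vrot2 o(2) avg_L2]
    show "energy \<Omega>2 \<epsilon> \<mu> (p (N - 1)) (E (N - 1)) (H N) = energy \<Omega>2 \<epsilon> \<mu> p0 E0 H0"
      using * by (intro energy_lf4_solution[where \<tau> = \<tau> and \<kappa>' = vrot2,
            OF assms(1) _ o(2) bounded_bilinear_rot2 N[OF *] sub avg]) blast+
  }
\<comment> \<open>What remains, once per dimension, is that the bound T is positive.\<close>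
qed (use assms in auto)

end
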